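(* Let $X$ be a compact metric space and $f:X\to X$ a homeomorphism. Then $f$ is equicontinuous if and only if $\inf_{n\in\mathbb{Z}}dist(f^n(x),f^n(K))>0$ for all $x\in X$ and all nonempty compact subsets $K$ of $X$ with $x\notin K$.
   Context: Let $d$ be the metric of $X$; $f^n$ denotes the $n$-th iterate of $f$ for $n\in\mathbb{Z}$. For $p\in X$ and nonempty $B\subset X$, $dist(p,B)=\inf\{d(p,b):b\in B\}$. $f$ is equicontinuous if for every $\epsilon>0$ there is $\delta>0$ such that $d(f^n(x),f^n(y))\leq\epsilon$ for all $n\in\mathbb{Z}$ whenever $x,y\in X$ satisfy $d(x,y)\leq\delta$. *)

theory Defs
  imports "HOL-Analysis.Analysis"
begin

(* Meaningful when f is a bijection of X onto itself: inv_into X f is then its inverse on X. *)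
definition int_iterate :: "'a set \<Rightarrow> ('a \<Rightarrow> 'a) \<Rightarrow> int \<Rightarrow> 'a \<Rightarrow> 'a" where
  "int_iterate X f n = (if 0 \<le> n then f ^^ nat n else inv_into X f ^^ nat (- n))"

definition equicontinuous_homeo :: "'a::metric_space set \<Rightarrow> ('a \<Rightarrow> 'a) \<Rightarrow> bool" where
  "equicontinuous_homeo X f \<longleftrightarrow>
     (\<forall>\<epsilon>>0. \<exists>\<delta>>0. \<forall>x\<in>X. \<forall>y\<in>X. dist x y \<le> \<delta> \<longrightarrow>
        (\<forall>n. dist (int_iterate X f n x) (int_iterate X f n y) \<le> \<epsilon>))"

end

theory Submission
  imports Defs
begin

text \<open>
  Write \<open>\<phi> n\<close> for the \<open>n\<close>-th iterate. If \<open>f\<close> is equicontinuous and some \<open>\<phi> n x\<close> is very close to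
  \<open>\<phi> n ` K\<close>, applying \<open>\<phi> (-n)\<close> shows that \<open>x\<close> is close to \<open>K\<close>.

  Conversely, applying the condition to \<open>K = X - ball x \<epsilon>\<close> gives a constant \<open>c\<close>, depending on \<open>x\<close>,
  such that \<open>dist (\<phi> n x) (\<phi> n y) < c\<close> for a single \<open>n\<close> forces \<open>dist x y < \<epsilon>\<close>. Hence every orbit
  closure \<open>M\<close> is minimal, and by Baire's theorem \<open>c\<close> can be chosen uniformly on a nonempty relatively
  open piece \<open>U\<close> of \<open>M\<close>. Suppose \<open>y\<^sub>j\<close> tends to \<open>x\<close> while \<open>\<phi> n\<^sub>j x\<close> and \<open>\<phi> n\<^sub>j y\<^sub>j\<close>
  tend to distinct points \<open>w\<close> and \<open>v\<close>, where \<open>M\<close> is the orbit closure of \<open>x\<close>. The orbit of \<open>w\<close>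
  visits \<open>U\<close>, at time \<open>m\<close> say. For large \<open>j\<close> the point \<open>\<phi> (m + n\<^sub>j) x\<close> lies in \<open>U\<close>, and
  \<open>\<phi> (- (m + n\<^sub>j))\<close> takes it and \<open>\<phi> (m + n\<^sub>j) y\<^sub>j\<close> to the close points \<open>x\<close> and \<open>y\<^sub>j\<close>,
  so \<open>dist (\<phi> m w) (\<phi> m v) \<le> \<epsilon>\<close>. As \<open>\<epsilon>\<close> is arbitrary, \<open>w\<close> and \<open>v\<close> are proximal, which
  contradicts the condition at \<open>w\<close>.
\<close>

section \<open>Actions of a group on a compact metric space\<close>

locale compact_action =
  fixes X :: "'a::metric_space set" and \<phi> :: "'g::group_add \<Rightarrow> 'a \<Rightarrow> 'a"
  assumes compact_space: "compact X"
    and cont: "continuous_on X (\<phi> n)"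
    and maps_to: "x \<in> X \<Longrightarrow> \<phi> n x \<in> X"
    and act_zero: "x \<in> X \<Longrightarrow> \<phi> 0 x = x"
    and act_add: "x \<in> X \<Longrightarrow> \<phi> (m + n) x = \<phi> m (\<phi> n x)"
begin

definition equicontinuous :: bool where
  "equicontinuous \<longleftrightarrow>
     (\<forall>\<epsilon>>0. \<exists>\<delta>>0. \<forall>x\<in>X. \<forall>y\<in>X. dist x y \<le> \<delta> \<longrightarrow> (\<forall>n. dist (\<phi> n x) (\<phi> n y) \<le> \<epsilon>))"

definition separates_compacts :: bool where
  "separates_compacts \<longleftrightarrow>
     (\<forall>x\<in>X. \<forall>K. K \<subseteq> X \<and> compact K \<and> K \<noteq> {} \<and> x \<notin> K \<longrightarrow>
       (INF n. infdist (\<phi> n x) (\<phi> n ` K)) > 0)"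

text \<open>Read backwards, the maps \<open>\<phi> (- n)\<close> have, at the orbit points
  \<open>\<phi> n x\<close>, a common modulus of continuity. This is the form in which the condition
  on compact sets enters the converse.\<close>

definition separates_points :: bool where
  "separates_points \<longleftrightarrow>
     (\<forall>x\<in>X. \<forall>\<epsilon>>0. \<exists>c>0. \<forall>n. \<forall>y\<in>X. dist (\<phi> n x) (\<phi> n y) < c \<longrightarrow> dist x y < \<epsilon>)"

lemma act_minus: "x \<in> X \<Longrightarrow> \<phi> (- n) (\<phi> n x) = x"
  and act_minus': "x \<in> X \<Longrightarrow> \<phi> n (\<phi> (- n) x) = x"
  by (metis act_add act_zero add.left_inverse, metis act_add act_zero add.right_inverse)

lemma act_tendsto:
  assumes "u \<longlonglongrightarrow> l" "l \<in> X" "\<And>j. u j \<in> X"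
  shows "(\<lambda>j. \<phi> n (u j)) \<longlonglongrightarrow> \<phi> n l"
  using continuous_on_tendsto_compose[OF cont assms(1,2)] assms(3) by simp

section \<open>Separation from compact sets and separation of points\<close>

lemma equicontinuous_imp_separates_compacts:
  assumes equicontinuous
  shows separates_compacts
  unfolding separates_compacts_def
proof (intro ballI allI impI, elim conjE)
  fix x K
  assume x: "x \<in> X" and K: "K \<subseteq> X" "compact K" "K \<noteq> {}" "x \<notin> K"
  have pos: "infdist x K > 0"
    using K by (simp add: compact_imp_closed infdist_pos_not_in_closed)
  \<comment> \<open>Half of \<open>infdist x K\<close>, because equicontinuity gives only a
    non-strict bound and the contradiction needs a distance strictly below
    \<open>infdist x K\<close>.\<close>
  obtain \<delta> where \<delta>: "\<delta> > 0"
    "\<And>a b n. a \<in> X \<Longrightarrow> b \<in> X \<Longrightarrow> dist a b \<le> \<delta> \<Longrightarrow> dist (\<phi> n a) (\<phi> n b) \<le> infdist x K / 2"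
    using assms pos unfolding equicontinuous_def by (meson half_gt_zero)
  have "\<delta> \<le> infdist (\<phi> n x) (\<phi> n ` K)" for n
  proof -
    have "\<delta> \<le> dist (\<phi> n x) (\<phi> n b)" if "b \<in> K" for b
    proof (rule ccontr)
      assume "\<not> ?thesis"
      moreover have "b \<in> X" using that K by auto
      ultimately have "dist (\<phi> (- n) (\<phi> n x)) (\<phi> (- n) (\<phi> n b)) \<le> infdist x K / 2"
        using \<delta>(2) maps_to x by auto
      then have "dist x b \<le> infdist x K / 2"
        using act_minus x \<open>b \<in> X\<close> by simp
      with infdist_le[OF that, of x] pos show False by linarith
    qed
    then show ?thesis
      using K by (auto simp: infdist_notempty intro!: cINF_greatest)
  qed
  then have "\<delta> \<le> (INF n. infdist (\<phi> n x) (\<phi> n ` K))"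
    by (intro cINF_greatest) auto
  with \<delta>(1) show "(INF n. infdist (\<phi> n x) (\<phi> n ` K)) > 0" by linarith
qed

lemma separates_compacts_imp_separates_points:
  assumes separates_compacts
  shows separates_points
  unfolding separates_points_def
proof (intro ballI allI impI)
  fix x and \<epsilon> :: real
  assume x: "x \<in> X" and \<epsilon>: "\<epsilon> > 0"
  define K where "K = X - ball x \<epsilon>"
  define c where "c = (INF n. infdist (\<phi> n x) (\<phi> n ` K))"
  show "\<exists>c>0. \<forall>n. \<forall>y\<in>X. dist (\<phi> n x) (\<phi> n y) < c \<longrightarrow> dist x y < \<epsilon>"
  \<comment> \<open>The hypothesis says nothing about an empty \<open>K\<close>; in that case
    \<open>X\<close> lies in the ball and any \<open>c\<close> works.\<close>
  proof (cases "K = {}")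
    case True
    then have "dist x y < \<epsilon>" if "y \<in> X" for y
      using that by (auto simp: K_def)
    then show ?thesis by (intro exI[of _ 1]) simp
  next
    case False
    have "compact K" "K \<subseteq> X" "x \<notin> K"
      using compact_space \<epsilon> by (auto simp: K_def compact_diff)
    then have "c > 0"
      using assms x False by (simp add: separates_compacts_def c_def)
    moreover have "dist x y < \<epsilon>" if y: "y \<in> X" and less: "dist (\<phi> n x) (\<phi> n y) < c" for n y
    proof (rule ccontr)
      assume "\<not> ?thesis"
      then have "\<phi> n y \<in> \<phi> n ` K" using y by (auto simp: K_def)
      then have "infdist (\<phi> n x) (\<phi> n ` K) \<le> dist (\<phi> n x) (\<phi> n y)" by (rule infdist_le)
      moreover have "c \<le> infdist (\<phi> n x) (\<phi> n ` K)"
        unfolding c_def by (rule cINF_lower) (auto intro!: bdd_belowI[of _ 0] infdist_nonneg)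
      ultimately show False using less by linarith
    qed
    ultimately show ?thesis by blast
  qed
qed

section \<open>Orbit closures and their minimality\<close>

definition orbit_closure :: "'a \<Rightarrow> 'a set" where
  "orbit_closure x = closure (range (\<lambda>n. \<phi> n x))"

lemma orbit_closure_subset: "x \<in> X \<Longrightarrow> orbit_closure x \<subseteq> X"
  unfolding orbit_closure_def
  using compact_space maps_to by (intro closure_minimal) (auto simp: compact_imp_closed)

lemma compact_orbit_closure: "x \<in> X \<Longrightarrow> compact (orbit_closure x)"
  using closed_Int_compact[OF closed_closure compact_space, of "range (\<lambda>n. \<phi> n x)"]
    orbit_closure_subset[of x]
  by (simp add: orbit_closure_def inf.absorb1)

lemma orbit_in_orbit_closure: "\<phi> n x \<in> orbit_closure x"
  unfolding orbit_closure_def by (rule subsetD[OF closure_subset rangeI])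

lemma act_orbit_closure:
  assumes "x \<in> X" "z \<in> orbit_closure x"
  shows "\<phi> n z \<in> orbit_closure x"
proof -
  have "continuous_on (closure (range (\<lambda>k. \<phi> k x))) (\<phi> n)"
    using cont orbit_closure_subset[OF assms(1)] continuous_on_subset
    unfolding orbit_closure_def by blast
  moreover have "\<phi> n ` range (\<lambda>k. \<phi> k x) \<subseteq> orbit_closure x"
    using orbit_in_orbit_closure assms(1) by (auto simp flip: act_add)
  ultimately show ?thesis
    using assms(2) image_closure_subset[of "range (\<lambda>k. \<phi> k x)" "\<phi> n" "orbit_closure x"]
    unfolding orbit_closure_def by auto
qed

text \<open>When \<open>\<phi> n x\<close> is within \<open>c\<close> of \<open>y\<close>,
  separation at \<open>x\<close>, applied to the point \<open>\<phi> (- n) y\<close>, puts that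
  point of the orbit of \<open>y\<close> near \<open>x\<close>.\<close>

lemma orbit_closure_symmetric:
  assumes separates_points and x: "x \<in> X" and y: "y \<in> orbit_closure x"
  shows "x \<in> orbit_closure y"
proof -
  have yX: "y \<in> X" using orbit_closure_subset x y by blast
  have "\<exists>n. dist x (\<phi> n y) < \<epsilon>" if "\<epsilon> > 0" for \<epsilon>
  proof -
    obtain c where c: "c > 0"
      "\<And>n b. b \<in> X \<Longrightarrow> dist (\<phi> n x) (\<phi> n b) < c \<Longrightarrow> dist x b < \<epsilon>"
      using assms(1) x \<open>\<epsilon> > 0\<close> unfolding separates_points_def by meson
    obtain n where "dist (\<phi> n x) y < c"
      using y c(1) unfolding orbit_closure_def closure_approachable by auto
    then show ?thesis
      using c(2)[of "\<phi> (- n) y" n] act_minus' maps_to yX by auto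
  qed
  then show ?thesis
    unfolding orbit_closure_def closure_approachable by (auto simp: dist_commute)
qed

text \<open>This is minimality: \<open>U\<close> contains some \<open>\<phi> i x\<close>, and by
  symmetry \<open>x\<close>, hence also \<open>\<phi> i x\<close>, lies in the orbit closure of
  \<open>w\<close>.\<close>

lemma orbit_meets_open:
  assumes separates_points and x: "x \<in> X" and w: "w \<in> orbit_closure x"
    and "open U" "z \<in> U" "z \<in> orbit_closure x"
  shows "\<exists>m. \<phi> m w \<in> U"
proof -
  obtain i where i: "\<phi> i x \<in> U"
    using assms(4-6) open_Int_closure_eq_empty[of U "range (\<lambda>n. \<phi> n x)"]
    unfolding orbit_closure_def by auto
  have "w \<in> X" using orbit_closure_subset x w by blast
  then have "\<phi> i x \<in> orbit_closure w"
    using act_orbit_closure orbit_closure_symmetric[OF assms(1-3)] by blast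
  then show ?thesis
    using i \<open>open U\<close> open_Int_closure_eq_empty[of U "range (\<lambda>n. \<phi> n w)"]
    unfolding orbit_closure_def by auto
qed

section \<open>Uniform separation by Baire category\<close>

lemma uniform_separation_on_open:
  assumes separates_points and M: "compact M" "M \<subseteq> X" "M \<noteq> {}" and "\<epsilon> > 0"
  obtains U c where "open U" "U \<inter> M \<noteq> {}" "c > 0"
    "\<And>n a b. a \<in> U \<inter> M \<Longrightarrow> b \<in> X \<Longrightarrow> dist (\<phi> n a) (\<phi> n b) < c \<Longrightarrow> dist a b \<le> \<epsilon>"
proof -
  \<comment> \<open>The points of \<open>M\<close> at which the constant \<open>1 / (k + 1)\<close>
    works. The premise is strict, so it passes from a limit to nearby points; the conclusion is
    non-strict, so it passes back to the limit. Hence \<open>C k\<close> is closed.\<close>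
  define C where "C k = {a \<in> M. \<forall>n. \<forall>b\<in>X. dist (\<phi> n a) (\<phi> n b) < inverse (real (Suc k))
    \<longrightarrow> dist a b \<le> \<epsilon>}" for k
  have closed_C: "closed (C k)" for k
    unfolding closed_sequential_limits
  proof (intro allI impI, elim conjE)
    fix u l assume u: "\<forall>j. u j \<in> C k" and lim: "u \<longlonglongrightarrow> l"
    have uM: "u j \<in> M" for j using u by (auto simp: C_def)
    then have l: "l \<in> M"
      using M(1) lim compact_imp_closed closed_sequentially by blast
    have "dist l b \<le> \<epsilon>"
      if b: "b \<in> X" and less: "dist (\<phi> n l) (\<phi> n b) < inverse (real (Suc k))" for n b
    proof -
      have "(\<lambda>j. dist (\<phi> n (u j)) (\<phi> n b)) \<longlonglongrightarrow> dist (\<phi> n l) (\<phi> n b)"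
        using act_tendsto[OF lim] l uM M(2) by (intro tendsto_intros) auto
      then have "\<forall>\<^sub>F j in sequentially. dist (\<phi> n (u j)) (\<phi> n b) < inverse (real (Suc k))"
        using less by (rule order_tendstoD)
      then have "\<forall>\<^sub>F j in sequentially. dist (u j) b \<le> \<epsilon>"
        by (rule eventually_mono) (use u b in \<open>auto simp: C_def\<close>)
      moreover have "(\<lambda>j. dist (u j) b) \<longlonglongrightarrow> dist l b"
        using lim by (intro tendsto_intros)
      ultimately show ?thesis
        by (intro tendsto_upperbound) auto
    qed
    with l show "l \<in> C k" by (auto simp: C_def)
  qed
  have cover: "(\<Union>k. C k) = M"
  proof -
    have "\<exists>k. a \<in> C k" if a: "a \<in> M" for a
    proof -
      obtain c where c: "c > 0" "\<And>n b. b \<in> X \<Longrightarrow> dist (\<phi> n a) (\<phi> n b) < c \<Longrightarrow> dist a b < \<epsilon>"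
        using assms(1) a M(2) \<open>\<epsilon> > 0\<close> unfolding separates_points_def by (meson subsetD)
      obtain k where "inverse (real (Suc k)) < c" using reals_Archimedean c(1) by blast
      then have "a \<in> C k"
        unfolding C_def using a c(2) by (blast intro: less_imp_le less_trans)
      then show ?thesis ..
    qed
    then show ?thesis by (auto simp: C_def)
  qed
  let ?T = "top_of_set M"
  \<comment> \<open>Otherwise \<open>M\<close> would be a countable union of closed sets with empty
    interior in \<open>M\<close>.\<close>
  have "\<exists>k. ?T interior_of C k \<noteq> {}"
  proof (rule ccontr)
    assume "\<nexists>k. ?T interior_of C k \<noteq> {}"
    moreover have "closedin ?T (C k)" for k
      using closed_C by (intro closed_subset) (auto simp: C_def)
    moreover have "locally_compact_space ?T"
      using M(1) by (simp add: compact_imp_locally_compact_space compact_space_subtopology)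
    moreover have "regular_space ?T"
      by (simp add: metrizable_imp_regular_space metrizable_space_euclidean metrizable_space_subtopology)
    ultimately have "?T interior_of (\<Union>(range C)) = {}"
      by (intro Baire_category_alt) auto
    moreover have "?T interior_of M = M"
      by (metis interior_of_topspace topspace_euclidean_subtopology)
    ultimately show False using cover M(3) by simp
  qed
  then obtain k T where "openin ?T T" "T \<subseteq> C k" "T \<noteq> {}"
    by (auto simp: interior_of_eq_empty)
  then obtain U where "open U" "U \<inter> M \<noteq> {}" "U \<inter> M \<subseteq> C k"
    by (metis Int_commute openin_open)
  then show thesis
    by (intro that[of U "inverse (real (Suc k))"]) (auto simp: C_def)
qed

section \<open>From separation of points to equicontinuity\<close>

lemma separates_points_imp_equicontinuous_at:
  assumes sep: separates_points and x: "x \<in> X" and "\<epsilon> > 0"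
  shows "\<exists>\<delta>>0. \<forall>y\<in>X. dist x y < \<delta> \<longrightarrow> (\<forall>n. dist (\<phi> n x) (\<phi> n y) < \<epsilon>)"
proof (rule ccontr)
  assume "\<not> ?thesis"
  then have "\<exists>y n. y \<in> X \<and> dist x y < inverse (real (Suc j)) \<and> \<epsilon> \<le> dist (\<phi> n x) (\<phi> n y)" for j
    by (metis inverse_positive_iff_positive not_le of_nat_0_less_iff zero_less_Suc)
  then obtain y t where y: "\<And>j. y j \<in> X" and close: "\<And>j. dist x (y j) < inverse (real (Suc j))"
    and far: "\<And>j. \<epsilon> \<le> dist (\<phi> (t j) x) (\<phi> (t j) (y j))"
    by metis
  have y_lim: "(\<lambda>j. dist x (y j)) \<longlonglongrightarrow> 0"
    by (rule real_tendsto_sandwich[OF _ _ tendsto_const LIMSEQ_inverse_real_of_nat])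
      (simp_all add: less_imp_le[OF close] del: of_nat_Suc)
  let ?M = "orbit_closure x"
  have "compact (?M \<times> X)"
    using compact_orbit_closure x compact_space by (intro compact_Times)
  \<comment> \<open>Compactness of the product gives one subsequence for both limits; the factor
    \<open>?M\<close> keeps \<open>w\<close> in the orbit closure of \<open>x\<close>.\<close>
  then obtain p r where p: "p \<in> ?M \<times> X" and r: "strict_mono r"
    and lim: "((\<lambda>j. (\<phi> (t j) x, \<phi> (t j) (y j))) \<circ> r) \<longlonglongrightarrow> p"
    by (rule seq_compactE[OF compact_imp_seq_compact, where f = "\<lambda>j. (\<phi> (t j) x, \<phi> (t j) (y j))"])
      (auto simp: orbit_in_orbit_closure maps_to y)
  obtain w v where p_eq: "p = (w, v)" by (cases p)
  have w: "w \<in> ?M" "w \<in> X" and v: "v \<in> X"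
    using p p_eq orbit_closure_subset[OF x] by auto
  define a b where "a j = \<phi> (t (r j)) x" and "b j = \<phi> (t (r j)) (y (r j))" for j
  have aX: "a j \<in> X" and aM: "a j \<in> ?M" and bX: "b j \<in> X" for j
    using x y maps_to orbit_in_orbit_closure by (auto simp: a_def b_def)
  have a_lim: "a \<longlonglongrightarrow> w" and b_lim: "b \<longlonglongrightarrow> v"
    using tendsto_fst[OF lim] tendsto_snd[OF lim] by (simp_all add: p_eq o_def a_def[abs_def] b_def[abs_def])
  have "(\<lambda>j. dist (a j) (b j)) \<longlonglongrightarrow> dist w v"
    using a_lim b_lim by (intro tendsto_intros)
  then have "\<epsilon> \<le> dist w v"
    by (rule tendsto_lowerbound) (auto simp: a_def b_def far)
  then have wv: "dist w v > 0" using \<open>\<epsilon> > 0\<close> by linarith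
  \<comment> \<open>With radius \<open>dist w v\<close>, the choice \<open>z = v\<close> shows that
    \<open>\<phi> n w\<close> and \<open>\<phi> n v\<close> stay at least \<open>c0\<close> apart
    for all \<open>n\<close>.\<close>
  obtain c0 where c0: "c0 > 0"
    "\<And>n z. z \<in> X \<Longrightarrow> dist (\<phi> n w) (\<phi> n z) < c0 \<Longrightarrow> dist w z < dist w v"
    using sep w(2) wv unfolding separates_points_def by meson
  have "?M \<noteq> {}" using w by blast
  \<comment> \<open>The tolerance \<open>c0 / 2\<close> leaves room for the passage to the limit,
    which preserves only a non-strict bound.\<close>
  then obtain U c where U: "open U" "U \<inter> ?M \<noteq> {}" "c > 0"
    "\<And>n a b. a \<in> U \<inter> ?M \<Longrightarrow> b \<in> X \<Longrightarrow> dist (\<phi> n a) (\<phi> n b) < c \<Longrightarrow> dist a b \<le> c0 / 2"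
    using uniform_separation_on_open[OF sep compact_orbit_closure[OF x] orbit_closure_subset[OF x]]
      half_gt_zero[OF c0(1)] by metis
  obtain m where m: "\<phi> m w \<in> U"
    using orbit_meets_open[OF sep x w(1) U(1)] U(2) by blast
  have am: "(\<lambda>j. \<phi> m (a j)) \<longlonglongrightarrow> \<phi> m w" and bm: "(\<lambda>j. \<phi> m (b j)) \<longlonglongrightarrow> \<phi> m v"
    using act_tendsto a_lim b_lim aX bX w v by blast+
  have "\<forall>\<^sub>F j in sequentially. \<phi> m (a j) \<in> U"
    using am U(1) m by (rule topological_tendstoD)
  moreover have "\<forall>\<^sub>F j in sequentially. dist x (y (r j)) < c"
    using order_tendstoD(2)[OF LIMSEQ_subseq_LIMSEQ[OF y_lim r] U(3)] by (simp add: o_def)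
  ultimately have "\<forall>\<^sub>F j in sequentially. dist (\<phi> m (a j)) (\<phi> m (b j)) \<le> c0 / 2"
  proof eventually_elim
    case (elim j)
    have return: "\<phi> (- (m + t (r j))) (\<phi> m (\<phi> (t (r j)) z)) = z" if "z \<in> X" for z
      using that act_minus by (simp flip: act_add)
    have "\<phi> m (a j) \<in> U \<inter> ?M"
      using elim(1) act_orbit_closure[OF x aM] by blast
    then show ?case
      using elim(2) U(4)[of "\<phi> m (a j)" "\<phi> m (b j)" "- (m + t (r j))"] maps_to bX return[OF x] return[OF y]
      by (simp add: a_def b_def)
  qed
  moreover have "(\<lambda>j. dist (\<phi> m (a j)) (\<phi> m (b j))) \<longlonglongrightarrow> dist (\<phi> m w) (\<phi> m v)"
    using am bm by (intro tendsto_intros)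
  ultimately have "dist (\<phi> m w) (\<phi> m v) \<le> c0 / 2"
    by (intro tendsto_upperbound) auto
  with c0 v have "dist w v < dist w v" by (intro c0(2)[of v m]) auto
  then show False by simp
qed

text \<open>Compactness makes the pointwise modulus uniform: counterexample pairs accumulate at a
  point \<open>l\<close>, and equicontinuity at \<open>l\<close> with \<open>\<epsilon> / 2\<close>
  bounds both members of a late pair against the image of \<open>l\<close>.\<close>

lemma separates_points_imp_equicontinuous:
  assumes sep: separates_points
  shows equicontinuous
  unfolding equicontinuous_def
proof (intro allI impI, rule ccontr)
  fix \<epsilon> :: real
  assume "\<epsilon> > 0" and
    neg: "\<not> (\<exists>\<delta>>0. \<forall>x\<in>X. \<forall>y\<in>X. dist x y \<le> \<delta> \<longrightarrow> (\<forall>n. dist (\<phi> n x) (\<phi> n y) \<le> \<epsilon>))"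
  have "\<exists>x y n. x \<in> X \<and> y \<in> X \<and> dist x y \<le> inverse (real (Suc j)) \<and> \<epsilon> < dist (\<phi> n x) (\<phi> n y)" for j
    using neg by (metis inverse_positive_iff_positive not_le of_nat_0_less_iff zero_less_Suc)
  then obtain x y t where xy: "\<And>j. x j \<in> X" "\<And>j. y j \<in> X"
    and close: "\<And>j. dist (x j) (y j) \<le> inverse (real (Suc j))"
    and far: "\<And>j. \<epsilon> < dist (\<phi> (t j) (x j)) (\<phi> (t j) (y j))"
    by metis
  have diff: "(\<lambda>j. dist (x j) (y j)) \<longlonglongrightarrow> 0"
    by (rule real_tendsto_sandwich[OF _ _ tendsto_const LIMSEQ_inverse_real_of_nat])
      (simp_all add: close del: of_nat_Suc)
  obtain l r where l: "l \<in> X" and r: "strict_mono r" and lim: "(x \<circ> r) \<longlonglongrightarrow> l"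
    using seq_compactE[OF compact_imp_seq_compact[OF compact_space]] xy(1) by metis
  obtain \<delta> where \<delta>: "\<delta> > 0"
    "\<And>z n. z \<in> X \<Longrightarrow> dist l z < \<delta> \<Longrightarrow> dist (\<phi> n l) (\<phi> n z) < \<epsilon> / 2"
    using separates_points_imp_equicontinuous_at[OF sep l half_gt_zero[OF \<open>\<epsilon> > 0\<close>]] by blast
  have "\<forall>\<^sub>F j in sequentially. dist ((x \<circ> r) j) l < \<delta> / 2"
    using tendstoD[OF lim half_gt_zero[OF \<delta>(1)]] .
  moreover have "\<forall>\<^sub>F j in sequentially. dist (x (r j)) (y (r j)) < \<delta> / 2"
    using order_tendstoD(2)[OF LIMSEQ_subseq_LIMSEQ[OF diff r] half_gt_zero[OF \<delta>(1)]]
    by (simp add: o_def)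
  ultimately have "\<forall>\<^sub>F j in sequentially. False"
  proof eventually_elim
    case (elim j)
    have lx: "dist l (x (r j)) < \<delta> / 2" using elim(1) by (simp add: dist_commute)
    then have "dist l (y (r j)) < \<delta>"
      using elim(2) dist_triangle[of l "y (r j)" "x (r j)"] by linarith
    then have "dist (\<phi> (t (r j)) l) (\<phi> (t (r j)) (y (r j))) < \<epsilon> / 2" using \<delta>(2) xy by blast
    moreover have "dist (\<phi> (t (r j)) l) (\<phi> (t (r j)) (x (r j))) < \<epsilon> / 2"
      using \<delta> lx xy by auto
    ultimately show False
      using far[of "r j"] dist_triangle3[of "\<phi> (t (r j)) (x (r j))" "\<phi> (t (r j)) (y (r j))" "\<phi> (t (r j)) l"]
      by linarith
  qed
  then show False by simp
qed

theorem equicontinuous_iff_separates_compacts: "equicontinuous \<longleftrightarrow> separates_compacts"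
  using equicontinuous_imp_separates_compacts separates_compacts_imp_separates_points
    separates_points_imp_equicontinuous by blast

end

section \<open>Integer iterates of a homeomorphism as an action\<close>

lemma compact_action_int_iterate:
  assumes "compact X" and hom: "homeomorphism X X f g"
  shows "compact_action X (int_iterate X f)"
proof -
  let ?h = "inv_into X f" and ?\<phi> = "int_iterate X f"
  have f: "f x \<in> X" "g (f x) = x" and g: "g x \<in> X" "f (g x) = x" if "x \<in> X" for x
    using hom that unfolding homeomorphism_def by auto
  have "inj_on f X" using f(2) by (rule inj_on_inverseI)
  then have h: "?h x = g x" if "x \<in> X" for x
    using that f g by (metis inv_into_f_f)
  have f_pow: "(f ^^ k) x \<in> X" and h_pow: "(?h ^^ k) x \<in> X" if "x \<in> X" for k x
    by (induction k) (use that f g h in auto)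
  have cont_f: "continuous_on X f" and "continuous_on X g"
    using hom by (auto simp: homeomorphism_def)
  then have cont_h: "continuous_on X ?h"
    using h by (metis continuous_on_cong)
  have cont_pow: "continuous_on X (u ^^ k)"
    if "continuous_on X u" "\<And>x k. x \<in> X \<Longrightarrow> (u ^^ k) x \<in> X" for u :: "'a \<Rightarrow> 'a" and k
  proof (induction k)
    case (Suc k)
    have "continuous_on X (u \<circ> u ^^ k)"
      using that Suc by (intro continuous_on_compose continuous_on_subset[OF that(1)]) auto
    then show ?case by (simp add: o_def)
  qed (simp add: id_def)
  have maps: "?\<phi> n x \<in> X" if "x \<in> X" for n x
    using f_pow h_pow that by (simp add: int_iterate_def)
  \<comment> \<open>The two branches of \<open>int_iterate\<close> are joined here; the group law
    \<open>add\<close> then follows from this law and \<open>pred\<close> by induction on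
    \<open>m\<close> in both directions.\<close>
  have succ: "?\<phi> (n + 1) x = f (?\<phi> n x)" if "x \<in> X" for n x
  proof (cases "0 \<le> n")
    case True
    then show ?thesis by (simp add: int_iterate_def nat_add_distrib)
  next
    case False
    then obtain k where n: "n = - int (Suc k)"
      by (metis int_cases of_nat_0_le_iff)
    \<comment> \<open>Here \<open>f\<close> cancels the outermost of \<open>k + 1\<close> inverses.
      For \<open>k = 0\<close> the index \<open>n + 1\<close> is zero and falls into the nonnegative
      branch.\<close>
    show ?thesis
      using h g h_pow[OF that, of k] by (cases "k = 0") (simp_all add: n int_iterate_def nat_add_distrib)
  qed
  have pred: "?\<phi> (n - 1) x = g (?\<phi> n x)" if "x \<in> X" for n x
    using succ[OF that, of "n - 1"] f(2) maps that by simp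
  have add: "?\<phi> (m + n) x = ?\<phi> m (?\<phi> n x)" if "x \<in> X" for m n x
  proof (induction m rule: int_induct[where k = 0])
    case base
    show ?case by (simp add: int_iterate_def)
  next
    case (step1 i)
    then show ?case using succ that maps by (metis add.commute add.left_commute)
  next
    case (step2 i)
    then show ?case using pred that maps by (metis add_diff_eq diff_add_eq)
  qed
  show ?thesis
  proof
    show "continuous_on X (?\<phi> n)" for n
      using cont_pow cont_f cont_h f_pow h_pow by (auto simp: int_iterate_def)
  qed (use assms(1) maps add in \<open>auto simp: int_iterate_def\<close>)
qed

theorem lemma2p5:
  fixes X :: "'a::metric_space set" and f :: "'a \<Rightarrow> 'a"
  assumes "compact X"
    and "\<exists>g. homeomorphism X X f g"
  shows "equicontinuous_homeo X f \<longleftrightarrow>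
    (\<forall>x\<in>X. \<forall>K. K \<subseteq> X \<and> compact K \<and> K \<noteq> {} \<and> x \<notin> K \<longrightarrow>
      (INF n. infdist (int_iterate X f n x) (int_iterate X f n ` K)) > 0)"
proof -
  interpret compact_action X "int_iterate X f"
    using assms compact_action_int_iterate by blast
  show ?thesis
    using equicontinuous_iff_separates_compacts
    unfolding equicontinuous_def separates_compacts_def equicontinuous_homeo_def .
qed

end
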